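(* Let $X$ be a connected partial groupoid. If $X$ has dimension $m$ with $m \geq |X_1\setminus X_0|$, then $X$ is a group.
   Context: Let $\mathbf{\Upsilon}$ be the category with objects $[n]=\{0,1,\dots,n\}$ for $n\ge 0$ and with all functions as morphisms. A symmetric set is a functor $X\colon \mathbf{\Upsilon}^{\mathrm{op}}\to \mathsf{Set}$; write $X_n$ for $X([n])$, and for $\alpha\colon[m]\to[n]$ write $x\mapsto x\cdot\alpha$ for the induced map $X_n\to X_m$. For $x\in X_n$ and $i,j\in[n]$, write $x_{ij}=x\cdot\alpha\in X_1$ where $\alpha\colon[1]\to[n]$, $\alpha(0)=i$, $\alpha(1)=j$. Elements of $X_0$ are objects and elements of $X_1$ are edges. The unique map $[1]\to[0]$ induces an injection $X_0\to X_1$ sending an object $x$ to the identity $\mathrm{id}_x$; $X_1\setminus X_0$ denotes the set of nonidentity edges, i.e. the complement of the image of this injection. For $n\ge 1$, a spine of $[n]$ is a tree $T$ with vertex set $[n]$; it gives a map $\mathscr{E}_T$ from $X_n$ to $\prod_{\{i,j\}\in T}X_1$ (product over the edges of $T$) whose $\{i,j\}$-component, for $i<j$, is $x\mapsto x_{ij}$. (Its image lies in the limit of the induced diagram, i.e. the subset of families of edges with matching endpoints; injectivity is unaffected by the choice of codomain.) A partial groupoid is a symmetric set $X$ that is spiny: $\mathscr{E}_T$ is injective for every $n\ge1$ and every spine $T$ of $[n]$. $X$ is a group if it is isomorphic, as a symmetric set, to the nerve of a group regarded as a one-object groupoid; here the nerve of a groupoid $\mathcal{G}$ has as $n$-simplices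 the functors to $\mathcal{G}$ from the groupoid with object set $[n]$ and exactly one morphism between any two objects. $X$ is connected if its underlying simplicial set (restriction to order-preserving maps) is connected; connected objects are nonempty by convention. Equivalently, $X_0\neq\emptyset$ and any two objects are joined by a zig-zag of edges, where an edge $f$ joins $f\cdot\iota_0$ and $f\cdot\iota_1$, with $\iota_k\colon[0]\to[1]$, $0\mapsto k$. A symmetric subset of $X$ is a subfunctor. For $X$ nonempty and $n\ge0$, $\mathrm{sk}_nX$ is the smallest symmetric subset of $X$ containing all of $X_n$, and $X$ is $n$-skeletal if $\mathrm{sk}_nX=X$. $X$ has dimension $n$ if it is $n$-skeletal but not $(n-1)$-skeletal (with the convention that a nonempty $X$ is never $(-1)$-skeletal). *)

theory Defs
  imports "HOL-Algebra.Group"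
begin

text \<open>
  The object \<open>[n]\<close> is \<open>{..n}\<close> and a morphism \<open>[m] \<rightarrow> [n]\<close> is an extensional function, so that
  equality of morphisms is equality in HOL. Since an extensional function on \<open>nat\<close> does not
  determine its domain and codomain, \<open>act X m n \<alpha>\<close> takes these explicitly.
  It is the map \<open>x \<mapsto> x \<cdot> \<alpha>\<close> from \<open>X\<^sub>n\<close> to \<open>X\<^sub>m\<close>.
\<close>

definition maps :: "nat \<Rightarrow> nat \<Rightarrow> (nat \<Rightarrow> nat) set" where
  "maps m n = {..m} \<rightarrow>\<^sub>E {..n}"

record 'a symset =
  simplices :: "nat \<Rightarrow> 'a set"
  act :: "nat \<Rightarrow> nat \<Rightarrow> (nat \<Rightarrow> nat) \<Rightarrow> 'a \<Rightarrow> 'a"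

locale symmetric_set =
  fixes X :: "'a symset"
  assumes act_closed:
      "\<lbrakk>\<alpha> \<in> maps m n; x \<in> simplices X n\<rbrakk> \<Longrightarrow> act X m n \<alpha> x \<in> simplices X m"
    and act_id:
      "x \<in> simplices X n \<Longrightarrow> act X n n (\<lambda>i\<in>{..n}. i) x = x"
    and act_comp:
      "\<lbrakk>\<alpha> \<in> maps k m; \<beta> \<in> maps m n; x \<in> simplices X n\<rbrakk>
        \<Longrightarrow> act X k n (compose {..k} \<beta> \<alpha>) x = act X k m \<alpha> (act X m n \<beta> x)"

definition symset_iso :: "'a symset \<Rightarrow> 'b symset \<Rightarrow> bool" where
  "symset_iso X Y \<longleftrightarrow>
    (\<exists>\<phi> :: nat \<Rightarrow> 'a \<Rightarrow> 'b.
      (\<forall>n. bij_betw (\<phi> n) (simplices X n) (simplices Y n)) \<and>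
      (\<forall>m n. \<forall>\<alpha>\<in>maps m n. \<forall>x\<in>simplices X n.
        \<phi> m (act X m n \<alpha> x) = act Y m n \<alpha> (\<phi> n x)))"

definition edge :: "'a symset \<Rightarrow> nat \<Rightarrow> 'a \<Rightarrow> nat \<Rightarrow> nat \<Rightarrow> 'a" where
  "edge X n x i j = act X 1 n (\<lambda>k\<in>{..1}. if k = 0 then i else j) x"

definition identity_edge :: "'a symset \<Rightarrow> 'a \<Rightarrow> 'a" where
  "identity_edge X x = act X 1 0 (\<lambda>k\<in>{..1}. 0) x"

definition nonidentity_edges :: "'a symset \<Rightarrow> 'a set" where
  "nonidentity_edges X = simplices X 1 - identity_edge X ` simplices X 0"


text \<open>Simple graphs are given by their sets of edges, each edge being a two-element set.\<close>

definition graph_on :: "'v set \<Rightarrow> 'v set set \<Rightarrow> bool" where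
  "graph_on V T \<longleftrightarrow> T \<subseteq> {{i, j} | i j. i \<in> V \<and> j \<in> V \<and> i \<noteq> j}"

definition graph_connected :: "'v set \<Rightarrow> 'v set set \<Rightarrow> bool" where
  "graph_connected V T \<longleftrightarrow> V \<noteq> {} \<and> (\<forall>i\<in>V. \<forall>j\<in>V. (i, j) \<in> {(a, b). {a, b} \<in> T}\<^sup>*)"

definition graph_cycle :: "'v set set \<Rightarrow> 'v list \<Rightarrow> bool" where
  "graph_cycle T vs \<longleftrightarrow> 3 \<le> length vs \<and> distinct vs \<and>
    (\<forall>i < length vs. {vs ! i, vs ! (Suc i mod length vs)} \<in> T)"

definition tree_on :: "'v set \<Rightarrow> 'v set set \<Rightarrow> bool" where
  "tree_on V T \<longleftrightarrow> graph_on V T \<and> graph_connected V T \<and> (\<nexists>vs. graph_cycle T vs)"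

definition spine :: "nat \<Rightarrow> nat set set \<Rightarrow> bool" where
  "spine n T \<longleftrightarrow> tree_on {..n} T"

definition spine_map :: "'a symset \<Rightarrow> nat \<Rightarrow> nat set set \<Rightarrow> 'a \<Rightarrow> nat set \<Rightarrow> 'a" where
  "spine_map X n T x = (\<lambda>e\<in>T. edge X n x (Min e) (Max e))"

locale partial_groupoid = symmetric_set +
  assumes spiny: "\<lbrakk>1 \<le> n; spine n T\<rbrakk> \<Longrightarrow> inj_on (spine_map X n T) (simplices X n)"


definition edge_relation :: "'a symset \<Rightarrow> 'a rel" where
  "edge_relation X =
    {(act X 0 1 (\<lambda>k\<in>{..0}. 0) f, act X 0 1 (\<lambda>k\<in>{..0}. 1) f) | f. f \<in> simplices X 1}"

definition connected_symset :: "'a symset \<Rightarrow> bool" where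
  "connected_symset X \<longleftrightarrow> simplices X 0 \<noteq> {} \<and>
    (\<forall>x\<in>simplices X 0. \<forall>y\<in>simplices X 0.
      (x, y) \<in> (edge_relation X \<union> (edge_relation X)\<inverse>)\<^sup>*)"


definition symmetric_subset :: "(nat \<Rightarrow> 'a set) \<Rightarrow> 'a symset \<Rightarrow> bool" where
  "symmetric_subset A X \<longleftrightarrow>
    (\<forall>n. A n \<subseteq> simplices X n) \<and>
    (\<forall>m n. \<forall>\<alpha>\<in>maps m n. \<forall>x\<in>A n. act X m n \<alpha> x \<in> A m)"

definition skeleton :: "nat \<Rightarrow> 'a symset \<Rightarrow> nat \<Rightarrow> 'a set" where
  "skeleton n X k = \<Inter> {A k | A. symmetric_subset A X \<and> simplices X n \<subseteq> A n}"

definition skeletal :: "nat \<Rightarrow> 'a symset \<Rightarrow> bool" where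
  "skeletal n X \<longleftrightarrow> skeleton n X = simplices X"

definition has_dimension :: "'a symset \<Rightarrow> nat \<Rightarrow> bool" where
  "has_dimension X n \<longleftrightarrow>
    (\<exists>k. simplices X k \<noteq> {}) \<and> skeletal n X \<and> (n = 0 \<or> \<not> skeletal (n - 1) X)"


text \<open>
  A functor from the groupoid with object set \<open>[n]\<close> and exactly one morphism \<open>i \<rightarrow> j\<close> for all
  \<open>i, j\<close> to the one-object groupoid of \<open>G\<close> is a family \<open>c (i, j)\<close>, the image of \<open>i \<rightarrow> j\<close>,
  that preserves identities and composition; composition \<open>g \<circ> f\<close> in that groupoid is \<open>g \<otimes>\<^bsub>G\<^esub> f\<close>.
\<close>

definition group_nerve :: "('g, 'b) monoid_scheme \<Rightarrow> (nat \<times> nat \<Rightarrow> 'g) symset" where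
  "group_nerve G =
    \<lparr>simplices = (\<lambda>n. {c \<in> {..n} \<times> {..n} \<rightarrow>\<^sub>E carrier G.
        (\<forall>i\<le>n. c (i, i) = \<one>\<^bsub>G\<^esub>) \<and>
        (\<forall>i\<le>n. \<forall>j\<le>n. \<forall>k\<le>n. c (i, k) = c (j, k) \<otimes>\<^bsub>G\<^esub> c (i, j))}),
     act = (\<lambda>m n \<alpha> c. \<lambda>(i, j)\<in>{..m} \<times> {..m}. c (\<alpha> i, \<alpha> j))\<rparr>"

lemma symmetric_set_group_nerve:
  assumes "group G"
  shows "symmetric_set (group_nerve G)"
proof
  fix \<alpha> m n c
  assume a: "\<alpha> \<in> maps m n" and c: "c \<in> simplices (group_nerve G) n"
  have "\<alpha> i \<le> n" if "i \<le> m" for i using a that by (auto simp: maps_def)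
  with c show "act (group_nerve G) m n \<alpha> c \<in> simplices (group_nerve G) m"
    by (auto simp: group_nerve_def PiE_iff)
next
  fix c n
  assume "c \<in> simplices (group_nerve G) n"
  then show "act (group_nerve G) n n (\<lambda>i\<in>{..n}. i) c = c"
    by (auto simp: group_nerve_def PiE_iff fun_eq_iff restrict_def extensional_def)
next
  fix \<alpha> k m \<beta> n c
  assume "\<alpha> \<in> maps k m"
  then show "act (group_nerve G) k n (compose {..k} \<beta> \<alpha>) c
      = act (group_nerve G) k m \<alpha> (act (group_nerve G) m n \<beta> c)"
    by (auto simp: group_nerve_def maps_def compose_def restrict_def fun_eq_iff PiE_iff)
qed

text \<open>
  If \<open>X\<close> is isomorphic to the nerve of \<open>G\<close>, then the carrier of \<open>G\<close> is in bijection with \<open>X\<^sub>1\<close>,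
  so it is no restriction to take \<open>G\<close> over the type of simplices of \<open>X\<close>.
\<close>

definition is_group_symset :: "'a symset \<Rightarrow> bool" where
  "is_group_symset X \<longleftrightarrow> (\<exists>G :: 'a monoid. group G \<and> symset_iso X (group_nerve G))"

end

theory Submission
  imports Defs
begin

text \<open>
  Call a simplex \<open>x\<close> of \<open>X\<close> universal if every edge \<open>f\<close> of \<open>X\<close> occurs in it with any prescribed
  starting vertex: for every \<open>c\<close> there is a \<open>j\<close> with \<open>f = x\<^sub>c\<^sub>j\<close>. A partial groupoid with a
  universal simplex is a group. Indeed, there is only one object, and every sequence of edges
  \<open>f\<^sub>1, \<dots>, f\<^sub>k\<close> can be followed inside \<open>x\<close>, as \<open>x\<^sub>0\<^sub>i, x\<^sub>i\<^sub>j, \<dots>\<close>. So every two edges have a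
  composite, which is unique by spininess, the group axioms hold because they hold along paths
  in \<open>x\<close>, and a map from \<open>[k]\<close> to the vertices of \<open>x\<close> pulls \<open>x\<close> back to a \<open>k\<close>-simplex with
  any given edges at the vertex 0. This makes the map from \<open>X\<close> to the nerve of the group
  bijective (\<open>universal_simplex.is_group\<close>).

  It remains to find a universal simplex. Since \<open>X\<close> has dimension \<open>m\<close>, it has a nondegenerate
  \<open>m\<close>-simplex \<open>x\<close>. The \<open>m + 1\<close> edges of \<open>x\<close> that start at a vertex \<open>c\<close> are distinct, because
  two equal ones would make \<open>x\<close> degenerate (\<open>degenerate_if_edges_eq\<close>). One of them is the
  identity \<open>x\<^sub>c\<^sub>c\<close>, so the others are \<open>m\<close> distinct nonidentity edges, and as there are at most
  \<open>m\<close> of those in \<open>X\<close>, they are all. Hence all nonidentity edges start at the same object;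
  applied to their reverses, this shows that they are loops. By connectedness, \<open>X\<close> has one
  object only, its identity is \<open>x\<^sub>c\<^sub>c\<close>, and \<open>x\<close> is universal.
\<close>

section \<open>Edges and vertices of a simplex\<close>

definition vertex :: "'a symset \<Rightarrow> nat \<Rightarrow> 'a \<Rightarrow> nat \<Rightarrow> 'a" where
  "vertex X n x i = act X 0 n (\<lambda>k\<in>{..0}. i) x"

context symmetric_set
begin

lemma vertex_closed: "\<lbrakk>x \<in> simplices X n; i \<le> n\<rbrakk> \<Longrightarrow> vertex X n x i \<in> simplices X 0"
  unfolding vertex_def by (rule act_closed) (auto simp: maps_def)

lemma edge_closed: "\<lbrakk>x \<in> simplices X n; i \<le> n; j \<le> n\<rbrakk> \<Longrightarrow> edge X n x i j \<in> simplices X 1"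
  unfolding edge_def by (rule act_closed) (auto simp: maps_def)

lemma edge_act:
  assumes a: "\<alpha> \<in> maps m n" and x: "x \<in> simplices X n" and i: "i \<le> m" and j: "j \<le> m"
  shows "edge X m (act X m n \<alpha> x) i j = edge X n x (\<alpha> i) (\<alpha> j)"
proof -
  have "(\<lambda>k\<in>{..1}. if k = 0 then i else j) \<in> maps 1 m"
    using i j by (auto simp: maps_def)
  moreover have "compose {..1} \<alpha> (\<lambda>k\<in>{..1}. if k = 0 then i else j)
      = (\<lambda>k\<in>{..1}. if k = 0 then \<alpha> i else \<alpha> j)"
    by (auto simp: compose_def restrict_def fun_eq_iff)
  ultimately show ?thesis
    unfolding edge_def using act_comp[OF _ a x] by metis
qed

lemma vertex_act:
  assumes a: "\<alpha> \<in> maps m n" and x: "x \<in> simplices X n" and i: "i \<le> m"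
  shows "vertex X m (act X m n \<alpha> x) i = vertex X n x (\<alpha> i)"
proof -
  have "(\<lambda>k\<in>{..0}. i) \<in> maps 0 m"
    using i by (auto simp: maps_def)
  moreover have "compose {..0} \<alpha> (\<lambda>k\<in>{..0}. i) = (\<lambda>k\<in>{..0}. \<alpha> i)"
    by (auto simp: compose_def restrict_def fun_eq_iff)
  ultimately show ?thesis
    unfolding vertex_def using act_comp[OF _ a x] by metis
qed

lemma edge_edge:
  assumes "x \<in> simplices X n" "i \<le> n" "j \<le> n" "p \<le> 1" "q \<le> 1"
  shows "edge X 1 (edge X n x i j) p q = edge X n x (if p = 0 then i else j) (if q = 0 then i else j)"
  using assms edge_act[of "\<lambda>k\<in>{..1}. if k = 0 then i else j" 1 n x p q]
  by (auto simp: edge_def maps_def)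

lemma vertex_edge:
  assumes "x \<in> simplices X n" "i \<le> n" "j \<le> n" "p \<le> 1"
  shows "vertex X 1 (edge X n x i j) p = vertex X n x (if p = 0 then i else j)"
  using assms vertex_act[of "\<lambda>k\<in>{..1}. if k = 0 then i else j" 1 n x p]
  by (auto simp: edge_def maps_def)

lemma edge_flip:
  "\<lbrakk>x \<in> simplices X n; i \<le> n; j \<le> n\<rbrakk> \<Longrightarrow> edge X n x j i = edge X 1 (edge X n x i j) 1 0"
  by (subst edge_edge) auto

lemma edge_of_edge:
  assumes "f \<in> simplices X 1"
  shows "edge X 1 f 0 1 = f"
proof -
  have "(\<lambda>k\<in>{..1}. if k = 0 then 0 else 1) = (\<lambda>i\<in>{..1}. i :: nat)"
    by (auto simp: restrict_def fun_eq_iff)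
  then show ?thesis unfolding edge_def using act_id[OF assms] by metis
qed

lemma identity_edge_vertex:
  assumes x: "x \<in> simplices X n" and i: "i \<le> n"
  shows "identity_edge X (vertex X n x i) = edge X n x i i"
proof -
  have "(\<lambda>k\<in>{..1}. 0 :: nat) \<in> maps 1 0" "(\<lambda>k\<in>{..0}. i) \<in> maps 0 n"
    using i by (auto simp: maps_def)
  moreover have "compose {..1} (\<lambda>k\<in>{..0}. i) (\<lambda>k\<in>{..1}. 0 :: nat)
      = (\<lambda>k\<in>{..1}. if k = 0 then i else i)"
    by (rule ext) (simp add: compose_def)
  ultimately show ?thesis
    unfolding identity_edge_def vertex_def edge_def using act_comp[OF _ _ x] by metis
qed

lemma vertex_of_object:
  assumes "v \<in> simplices X 0"
  shows "vertex X 0 v 0 = v"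
proof -
  have "(\<lambda>k\<in>{..0}. 0) = (\<lambda>i\<in>{..0}. i :: nat)"
    by (auto simp: restrict_def fun_eq_iff)
  then show ?thesis unfolding vertex_def using act_id[OF assms] by metis
qed

lemma identity_edge_closed: "v \<in> simplices X 0 \<Longrightarrow> identity_edge X v \<in> simplices X 1"
  unfolding identity_edge_def by (rule act_closed) (auto simp: maps_def)

lemma vertex_identity_edge:
  assumes "v \<in> simplices X 0" "p \<le> 1"
  shows "vertex X 1 (identity_edge X v) p = v"
  using assms vertex_act[of "\<lambda>k\<in>{..1}. 0" 1 0 v p] vertex_of_object[of v]
  by (auto simp: identity_edge_def maps_def)

text \<open>The object of an identity edge can be read off from its source, so an identity edge
  \<open>x\<^sub>i\<^sub>j\<close> can only be \<open>x\<^sub>i\<^sub>i\<close>.\<close>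

lemma edge_identity_iff:
  assumes x: "x \<in> simplices X n" and i: "i \<le> n" and j: "j \<le> n"
  shows "edge X n x i j \<in> identity_edge X ` simplices X 0 \<longleftrightarrow> edge X n x i j = edge X n x i i"
proof
  assume "edge X n x i j \<in> identity_edge X ` simplices X 0"
  then obtain v where v: "v \<in> simplices X 0" "edge X n x i j = identity_edge X v" by auto
  then have "v = vertex X n x i"
    using vertex_edge[OF x i j, of 0] vertex_identity_edge[of v 0] by simp
  with v show "edge X n x i j = edge X n x i i"
    using identity_edge_vertex[OF x i] by simp
qed (metis identity_edge_vertex[OF x i] vertex_closed[OF x i] imageI)

end

section \<open>Simplices are determined by their edges at one vertex\<close>

lemma spine_star:
  assumes c: "c \<le> n"
  shows "spine n {{c, k} | k. k \<le> n \<and> k \<noteq> c}" (is "spine n ?T")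
proof -
  have "graph_on {..n} ?T"
    using c unfolding graph_on_def by auto
  moreover have "graph_connected {..n} ?T"
  proof -
    have inward: "(i, c) \<in> {(a, b). {a, b} \<in> ?T}\<^sup>*" and outward: "(c, i) \<in> {(a, b). {a, b} \<in> ?T}\<^sup>*"
      if "i \<le> n" for i
      using that by (cases "i = c"; force simp: insert_commute)+
    show ?thesis
      using c inward outward unfolding graph_connected_def
      by (metis (no_types, lifting) atMost_iff empty_iff rtrancl_trans)
  qed
  moreover have "\<not> graph_cycle ?T vs" for vs
  proof
    assume "graph_cycle ?T vs"
    then have len: "3 \<le> length vs" and dist: "distinct vs"
      and T: "\<And>i. i < length vs \<Longrightarrow> {vs ! i, vs ! (Suc i mod length vs)} \<in> ?T"
      unfolding graph_cycle_def by blast+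
    have c_in: "c = vs ! i \<or> c = vs ! (Suc i mod length vs)" if "i < length vs" for i
      using T[OF that] by blast
    have "Suc 0 mod length vs = 1" "Suc 1 mod length vs = 2" "0 < length vs" "1 < length vs"
      using len by (simp_all del: length_greater_0_conv)
    then have 01: "c = vs ! 0 \<or> c = vs ! 1" and 12: "c = vs ! 1 \<or> c = vs ! 2"
      using c_in[of 0] c_in[of 1] by metis+
    have neq: "vs ! p \<noteq> vs ! q" if "p < length vs" "q < length vs" "p \<noteq> q" for p q
      using dist that by (simp add: nth_eq_iff_index_eq)
    have c1: "c = vs ! 1"
      using 01 12 neq[of 0 2] len by force
    \<comment> \<open>All edges contain \<open>c\<close>, but the edge after index 2 avoids index 1.
      The successor of index 2 is 3, or 0 in a triangle; it is never 1.\<close>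
    have succ: "Suc 2 mod length vs \<noteq> 1" "Suc 2 mod length vs < length vs"
      using len by (cases "length vs = 3"; simp)+
    have "vs ! 1 \<noteq> vs ! 2" "vs ! 1 \<noteq> vs ! (Suc 2 mod length vs)"
      using neq[of 1 2] neq[OF _ succ(2), of 1] succ(1) len by simp_all
    with c1 c_in[of 2] len show False
      by simp
  qed
  ultimately show ?thesis
    unfolding spine_def tree_on_def by blast
qed

context partial_groupoid
begin

text \<open>The edges at \<open>c\<close> form a spine. The spine map records \<open>x\<^sub>k\<^sub>c\<close> instead of \<open>x\<^sub>c\<^sub>k\<close> when \<open>k < c\<close>,
  but each of the two is the reverse of the other.\<close>

lemma simplex_eqI:
  assumes x: "x \<in> simplices X n" and y: "y \<in> simplices X n" and c: "c \<le> n"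
    and eq: "\<And>k. k \<le> n \<Longrightarrow> edge X n x c k = edge X n y c k"
  shows "x = y"
proof (cases "n = 0")
  case True
  \<comment> \<open>There is no spine of \<open>[0]\<close>, but an object is the source of its identity.\<close>
  have "v = vertex X 1 (edge X 0 v 0 0) 0" if "v \<in> simplices X 0" for v
    using vertex_edge[OF that, of 0 0 0] vertex_of_object[OF that] by simp
  from this[of x] this[of y] True eq[of 0] x y c show ?thesis
    by simp
next
  case False
  let ?T = "{{c, k} | k. k \<le> n \<and> k \<noteq> c}"
  have "inj_on (spine_map X n ?T) (simplices X n)"
    using spiny spine_star[OF c] False by simp
  moreover have "spine_map X n ?T x = spine_map X n ?T y"
    unfolding spine_map_def
  proof (rule restrict_ext)
    fix e assume "e \<in> ?T"
    then obtain k where k: "e = {c, k}" "k \<le> n" "k \<noteq> c" by blast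
    have "edge X n x k c = edge X n y k c"
      using edge_flip[OF x c k(2)] edge_flip[OF y c k(2)] eq[OF k(2)] by simp
    with eq[OF k(2)] show "edge X n x (Min e) (Max e) = edge X n y (Min e) (Max e)"
      unfolding k(1) by (cases "c < k") (auto simp: min_def max_def)
  qed
  ultimately show ?thesis using x y by (auto dest: inj_onD)
qed

section \<open>Nondegenerate simplices\<close>

text \<open>If two edges at \<open>c\<close> coincide, then replacing one of their endpoints by the other does not
  change the edges at \<open>c\<close>, and hence not the simplex, which is therefore degenerate.\<close>

lemma degenerate_if_edges_eq:
  assumes x: "x \<in> simplices X n" and le: "c \<le> n" "i \<le> n" "j \<le> n"
    and eq: "edge X n x c i = edge X n x c j" and neq: "i \<noteq> j"
  shows "\<exists>\<alpha>\<in>maps n (n - 1). \<exists>y\<in>simplices X (n - 1). x = act X n (n - 1) \<alpha> y"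
proof -
  have "\<exists>i j. i \<le> n \<and> j \<le> n \<and> i \<noteq> j \<and> c \<noteq> j \<and> edge X n x c i = edge X n x c j"
    using le eq neq by (cases "c = j") metis+
  then obtain i j where ij: "i \<le> n" "j \<le> n" "i \<noteq> j" "c \<noteq> j"
    and eq: "edge X n x c i = edge X n x c j" by blast
  \<comment> \<open>\<open>\<delta>\<close> inserts a gap at \<open>j\<close> and \<open>\<beta>\<close> closes it after sending \<open>j\<close> to \<open>i\<close>, so that
    \<open>\<delta> \<circ> \<beta>\<close> sends \<open>j\<close> to \<open>i\<close> and fixes all other vertices.\<close>
  define \<delta> where "\<delta> = (\<lambda>k\<in>{..n - 1}. if k < j then k else Suc k)"
  define \<beta> where "\<beta> = (\<lambda>k\<in>{..n}. let l = if k = j then i else k in if l < j then l else l - 1)"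
  have \<delta>: "\<delta> \<in> maps (n - 1) n" and \<beta>: "\<beta> \<in> maps n (n - 1)"
    using ij by (auto simp: \<delta>_def \<beta>_def maps_def Let_def)
  have \<delta>\<beta>: "\<delta> (\<beta> k) = (if k = j then i else k)" if "k \<le> n" for k
    using that ij by (auto simp: \<delta>_def \<beta>_def Let_def)
  let ?y = "act X (n - 1) n \<delta> x"
  have y: "?y \<in> simplices X (n - 1)" by (rule act_closed[OF \<delta> x])
  have "x = act X n (n - 1) \<beta> ?y"
  proof (rule simplex_eqI[OF x act_closed[OF \<beta> y] le(1)])
    fix k assume k: "k \<le> n"
    have "\<beta> c \<le> n - 1" "\<beta> k \<le> n - 1"
      using \<beta> le(1) k by (auto simp: maps_def PiE_iff)
    then have "edge X n (act X n (n - 1) \<beta> ?y) c k = edge X n x (\<delta> (\<beta> c)) (\<delta> (\<beta> k))"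
      using edge_act[OF \<beta> y le(1) k] edge_act[OF \<delta> x] by simp
    then show "edge X n x c k = edge X n (act X n (n - 1) \<beta> ?y) c k"
      using \<delta>\<beta>[OF le(1)] \<delta>\<beta>[OF k] ij(4) eq by auto
  qed
  with \<beta> y show ?thesis by blast
qed

end

lemma (in symmetric_set) skeleton_subset: "skeleton n X k \<subseteq> simplices X k"
proof -
  have "symmetric_subset (simplices X) X"
    unfolding symmetric_subset_def using act_closed by auto
  then show ?thesis unfolding skeleton_def by blast
qed

text \<open>If all \<open>n\<close>-simplices were degenerate, then a symmetric subset with all of \<open>X\<^sub>n\<^sub>-\<^sub>1\<close> would
  contain all of \<open>X\<^sub>n\<close>, so \<open>X = sk\<^sub>n X\<close> would be \<open>(n - 1)\<close>-skeletal.\<close>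

lemma (in symmetric_set) dimension_nondegenerate_simplex:
  assumes dim: "has_dimension X n" and n: "n \<noteq> 0"
  shows "\<exists>x\<in>simplices X n.
    \<not> (\<exists>\<alpha>\<in>maps n (n - 1). \<exists>y\<in>simplices X (n - 1). x = act X n (n - 1) \<alpha> y)"
proof (rule ccontr)
  assume "\<not> ?thesis"
  then have deg: "\<exists>\<alpha>\<in>maps n (n - 1). \<exists>y\<in>simplices X (n - 1). x = act X n (n - 1) \<alpha> y"
    if "x \<in> simplices X n" for x
    using that by blast
  have "simplices X n \<subseteq> A n" if "symmetric_subset A X" "simplices X (n - 1) \<subseteq> A (n - 1)" for A
    using that deg unfolding symmetric_subset_def by blast
  then have "skeleton n X k \<subseteq> skeleton (n - 1) X k" for k
    unfolding skeleton_def by blast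
  moreover have "skeleton n X k = simplices X k" for k
    using dim unfolding has_dimension_def skeletal_def by simp
  ultimately have "skeleton (n - 1) X = simplices X"
    using skeleton_subset by (intro ext) blast
  then show False
    using dim n unfolding has_dimension_def skeletal_def by simp
qed

lemma (in partial_groupoid) dimension_edges_distinct:
  assumes dim: "has_dimension X n"
  obtains x where "x \<in> simplices X n" "\<And>c. c \<le> n \<Longrightarrow> inj_on (edge X n x c) {..n}"
proof (cases "n = 0")
  case True
  from dim obtain k y where "y \<in> simplices X k"
    unfolding has_dimension_def by blast
  then have "vertex X k y 0 \<in> simplices X n"
    using True vertex_closed by simp
  with True that show thesis by (auto simp: inj_on_def)
next
  case False
  with dimension_nondegenerate_simplex[OF dim] obtain x where "x \<in> simplices X n"
    "\<not> (\<exists>\<alpha>\<in>maps n (n - 1). \<exists>y\<in>simplices X (n - 1). x = act X n (n - 1) \<alpha> y)" by blast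
  with degenerate_if_edges_eq that show thesis
    unfolding inj_on_def by (metis atMost_iff)
qed

section \<open>A simplex with all edges at every vertex\<close>

text \<open>The arguments are in the order of composition of morphisms: \<open>f\<close> is the first edge of the
  path. In a partial groupoid, this is a partial operation, unspecified if no 2-simplex has
  \<open>f\<close> and \<open>g\<close> as consecutive edges.\<close>

definition composite :: "'a symset \<Rightarrow> 'a \<Rightarrow> 'a \<Rightarrow> 'a" where
  "composite X g f =
    (THE h. \<exists>z\<in>simplices X 2. edge X 2 z 0 1 = f \<and> edge X 2 z 1 2 = g \<and> edge X 2 z 0 2 = h)"

definition edge_monoid :: "'a symset \<Rightarrow> 'a \<Rightarrow> 'a monoid" where
  "edge_monoid X e = \<lparr>carrier = simplices X 1, mult = composite X, one = e\<rparr>"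

text \<open>A 2-simplex is determined by its edges at the vertex 1, that is, by the path that it fills.\<close>

lemma (in partial_groupoid) composite_edges:
  assumes x: "x \<in> simplices X n" and le: "i \<le> n" "j \<le> n" "k \<le> n"
  shows "composite X (edge X n x j k) (edge X n x i j) = edge X n x i k"
  unfolding composite_def
proof (rule the_equality)
  define \<alpha> where "\<alpha> = (\<lambda>p\<in>{..2 :: nat}. if p = 0 then i else if p = 1 then j else k)"
  have \<alpha>: "\<alpha> \<in> maps 2 n" using le by (auto simp: \<alpha>_def maps_def)
  let ?z = "act X 2 n \<alpha> x"
  have z: "?z \<in> simplices X 2" by (rule act_closed[OF \<alpha> x])
  have ze: "edge X 2 ?z 0 1 = edge X n x i j" "edge X 2 ?z 1 2 = edge X n x j k"
    "edge X 2 ?z 0 2 = edge X n x i k"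
    using edge_act[OF \<alpha> x, of 0 1] edge_act[OF \<alpha> x, of 1 2] edge_act[OF \<alpha> x, of 0 2]
    by (auto simp: \<alpha>_def)
  with z show "\<exists>z\<in>simplices X 2. edge X 2 z 0 1 = edge X n x i j
    \<and> edge X 2 z 1 2 = edge X n x j k \<and> edge X 2 z 0 2 = edge X n x i k" by blast
  fix h
  assume "\<exists>z\<in>simplices X 2. edge X 2 z 0 1 = edge X n x i j
    \<and> edge X 2 z 1 2 = edge X n x j k \<and> edge X 2 z 0 2 = h"
  then obtain w where w: "w \<in> simplices X 2" and we: "edge X 2 w 0 1 = edge X n x i j"
    "edge X 2 w 1 2 = edge X n x j k" "edge X 2 w 0 2 = h" by blast
  have "w = ?z"
  proof (rule simplex_eqI[OF w z, of 1])
    fix p :: nat assume "p \<le> 2"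
    then consider "p = 0" | "p = 1" | "p = 2" by linarith
    then show "edge X 2 w 1 p = edge X 2 ?z 1 p"
    proof cases
      case 1
      then show ?thesis
        using edge_flip[OF w, of 0 1] edge_flip[OF z, of 0 1] we(1) ze(1) by simp
    next
      case 2
      then show ?thesis
        using edge_edge[OF w, of 0 1 1 1] edge_edge[OF z, of 0 1 1 1] we(1) ze(1) by simp
    next
      case 3
      then show ?thesis using we(2) ze(2) by simp
    qed
  qed simp
  then show "h = edge X n x i k" using we(3) ze(3) by simp
qed

locale universal_simplex = partial_groupoid +
  fixes x :: 'a and n :: nat
  assumes x: "x \<in> simplices X n"
    and all_edges: "\<lbrakk>c \<le> n; f \<in> simplices X 1\<rbrakk> \<Longrightarrow> \<exists>j\<le>n. edge X n x c j = f"
begin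

abbreviation G :: "'a monoid" where
  "G \<equiv> edge_monoid X (edge X n x 0 0)"

text \<open>The identity of \<open>v\<close> starts at \<open>v\<close>, but as an edge \<open>x\<^sub>0\<^sub>j\<close> it also starts at the vertex 0
  of \<open>x\<close>.\<close>

lemma object_unique:
  assumes "v \<in> simplices X 0"
  shows "v = vertex X n x 0"
proof -
  obtain j where "j \<le> n" "edge X n x 0 j = identity_edge X v"
    using all_edges[of 0] identity_edge_closed[OF assms] by blast
  then show ?thesis
    using vertex_edge[OF x, of 0 j 0] vertex_identity_edge[OF assms, of 0] by simp
qed

lemma edge_diagonal:
  assumes "y \<in> simplices X k" "i \<le> k"
  shows "edge X k y i i = edge X n x 0 0"
  using identity_edge_vertex[OF assms] identity_edge_vertex[OF x, of 0]
    object_unique[OF vertex_closed[OF assms]] by simp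

text \<open>Any chain of edges is traced by a path in \<open>x\<close>, so every identity of the group law can be
  checked on edges of \<open>x\<close>, where the composite of \<open>x\<^sub>i\<^sub>j\<close> and \<open>x\<^sub>j\<^sub>k\<close> is \<open>x\<^sub>i\<^sub>k\<close>.\<close>

lemma group_edges: "group G"
proof (rule groupI)
  fix f g assume "f \<in> carrier G" "g \<in> carrier G"
  then have fg: "f \<in> simplices X 1" "g \<in> simplices X 1" by (auto simp: edge_monoid_def)
  from all_edges[of 0 g] fg obtain i where i: "i \<le> n" "edge X n x 0 i = g" by blast
  from all_edges[OF i(1) fg(1)] obtain j where j: "j \<le> n" "edge X n x i j = f" by blast
  have "composite X f g = edge X n x 0 j"
    using composite_edges[OF x, of 0 i j] i j by simp
  then show "f \<otimes>\<^bsub>G\<^esub> g \<in> carrier G"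
    using edge_closed[OF x _ j(1)] by (simp add: edge_monoid_def)
  fix h assume "h \<in> carrier G"
  then have h: "h \<in> simplices X 1" by (auto simp: edge_monoid_def)
  obtain a where a: "a \<le> n" "edge X n x 0 a = h"
    using all_edges[of 0 h] h by blast
  obtain b where b: "b \<le> n" "edge X n x a b = g"
    using all_edges[OF a(1) fg(2)] by blast
  obtain c where c: "c \<le> n" "edge X n x b c = f"
    using all_edges[OF b(1) fg(1)] by blast
  have "composite X f g = edge X n x a c" "composite X g h = edge X n x 0 b"
    "composite X (edge X n x a c) h = edge X n x 0 c"
    "composite X f (edge X n x 0 b) = edge X n x 0 c"
    using composite_edges[OF x, of a b c] composite_edges[OF x, of 0 a b]
      composite_edges[OF x, of 0 a c] composite_edges[OF x, of 0 b c] a b c by simp_all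
  then show "f \<otimes>\<^bsub>G\<^esub> g \<otimes>\<^bsub>G\<^esub> h = f \<otimes>\<^bsub>G\<^esub> (g \<otimes>\<^bsub>G\<^esub> h)"
    by (simp add: edge_monoid_def)
next
  show "\<one>\<^bsub>G\<^esub> \<in> carrier G"
    using edge_closed[OF x, of 0 0] by (simp add: edge_monoid_def)
next
  fix f assume "f \<in> carrier G"
  then have "f \<in> simplices X 1" by (simp add: edge_monoid_def)
  then obtain i where i: "i \<le> n" "edge X n x 0 i = f" using all_edges[of 0] by blast
  show "\<one>\<^bsub>G\<^esub> \<otimes>\<^bsub>G\<^esub> f = f"
    using composite_edges[OF x, of 0 i i] edge_diagonal[OF x i(1)] i
    by (simp add: edge_monoid_def)
  have "edge X n x i 0 \<in> carrier G"
    using edge_closed[OF x i(1), of 0] by (simp add: edge_monoid_def)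
  moreover have "edge X n x i 0 \<otimes>\<^bsub>G\<^esub> f = \<one>\<^bsub>G\<^esub>"
    using composite_edges[OF x, of 0 i 0] i by (simp add: edge_monoid_def)
  ultimately show "\<exists>g\<in>carrier G. g \<otimes>\<^bsub>G\<^esub> f = \<one>\<^bsub>G\<^esub>" by blast
qed

definition edge_family :: "nat \<Rightarrow> 'a \<Rightarrow> nat \<times> nat \<Rightarrow> 'a" where
  "edge_family k y = (\<lambda>(i, j)\<in>{..k} \<times> {..k}. edge X k y i j)"

lemma edge_family_apply: "\<lbrakk>i \<le> k; j \<le> k\<rbrakk> \<Longrightarrow> edge_family k y (i, j) = edge X k y i j"
  by (simp add: edge_family_def)

text \<open>Given \<open>c\<close> in the nerve, choose vertices \<open>p j\<close> of \<open>x\<close> with \<open>x\<^sub>0\<^sub>,\<^sub>p\<^sub>j = c (0, j)\<close>. The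
  \<open>k\<close>-simplex that \<open>p\<close> picks out of \<open>x\<close> has the same edges at the vertex 0 as \<open>c\<close>, and by
  cancellation in the group these determine all others.\<close>

lemma edge_family_bij: "bij_betw (edge_family k) (simplices X k) (simplices (group_nerve G) k)"
  unfolding bij_betw_def
proof
  show "inj_on (edge_family k) (simplices X k)"
  proof (rule inj_onI)
    fix y z assume yz: "y \<in> simplices X k" "z \<in> simplices X k"
      and eq: "edge_family k y = edge_family k z"
    show "y = z"
    proof (rule simplex_eqI[OF yz, of 0])
      fix j assume "j \<le> k"
      then show "edge X k y 0 j = edge X k z 0 j"
        using edge_family_apply[of 0 k j] eq by (metis le0)
    qed simp
  qed
  show "edge_family k ` simplices X k = simplices (group_nerve G) k"
  proof
    show "edge_family k ` simplices X k \<subseteq> simplices (group_nerve G) k"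
    proof (rule image_subsetI)
      fix y assume y: "y \<in> simplices X k"
      have "edge_family k y \<in> {..k} \<times> {..k} \<rightarrow>\<^sub>E carrier G"
        unfolding edge_family_def using edge_closed[OF y] by (auto simp: edge_monoid_def)
      then show "edge_family k y \<in> simplices (group_nerve G) k"
        using edge_diagonal[OF y] composite_edges[OF y]
        by (simp add: group_nerve_def edge_family_apply edge_monoid_def)
    qed
  next
    interpret group G by (rule group_edges)
    show "simplices (group_nerve G) k \<subseteq> edge_family k ` simplices X k"
    proof
      fix c assume "c \<in> simplices (group_nerve G) k"
      then have ext: "c \<in> {..k} \<times> {..k} \<rightarrow>\<^sub>E carrier G"
        and comp: "\<And>i j l. \<lbrakk>i \<le> k; j \<le> k; l \<le> k\<rbrakk> \<Longrightarrow> c (i, l) = c (j, l) \<otimes>\<^bsub>G\<^esub> c (i, j)"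
        unfolding group_nerve_def symset.select_convs mem_Collect_eq by blast+
      have carr: "c (i, j) \<in> carrier G" if "i \<le> k" "j \<le> k" for i j
        using ext that by (auto simp: PiE_iff)
      have "\<exists>p\<le>n. edge X n x 0 p = c (0, j)" if "j \<le> k" for j
        using all_edges carr[OF _ that, of 0] by (simp add: edge_monoid_def)
      then obtain p where p: "\<And>j. j \<le> k \<Longrightarrow> p j \<le> n"
        "\<And>j. j \<le> k \<Longrightarrow> edge X n x 0 (p j) = c (0, j)" by metis
      define \<alpha> where "\<alpha> = (\<lambda>j\<in>{..k}. p j)"
      have \<alpha>: "\<alpha> \<in> maps k n" using p(1) by (auto simp: \<alpha>_def maps_def)
      define y where "y = act X k n \<alpha> x"
      have y: "y \<in> simplices X k" unfolding y_def by (rule act_closed[OF \<alpha> x])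
      have ye: "edge X k y i j = edge X n x (p i) (p j)" if "i \<le> k" "j \<le> k" for i j
        unfolding y_def using edge_act[OF \<alpha> x that] that by (simp add: \<alpha>_def)
      have "edge X k y i j = c (i, j)" if ij: "i \<le> k" "j \<le> k" for i j
      proof -
        \<comment> \<open>Composed with \<open>c (0, i)\<close>, both sides give \<open>c (0, j)\<close>.\<close>
        have "edge X k y i j \<otimes>\<^bsub>G\<^esub> c (0, i) = c (0, j)"
          using composite_edges[OF x, of 0 "p i" "p j"] p ij ye[OF ij]
          by (simp add: edge_monoid_def)
        also have "\<dots> = c (i, j) \<otimes>\<^bsub>G\<^esub> c (0, i)" by (rule comp) (use ij in simp_all)
        finally have "edge X k y i j \<otimes>\<^bsub>G\<^esub> c (0, i) = c (i, j) \<otimes>\<^bsub>G\<^esub> c (0, i)" .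
        moreover have "edge X k y i j \<in> carrier G"
          using edge_closed[OF y ij] by (simp add: edge_monoid_def)
        ultimately show ?thesis
          using right_cancel carr[OF le0 ij(1)] carr[OF ij] by blast
      qed
      then have "c = edge_family k y"
        using ext by (auto simp: fun_eq_iff edge_family_def PiE_iff extensional_def)
      with y show "c \<in> edge_family k ` simplices X k" by blast
    qed
  qed
qed

lemma edge_family_natural:
  assumes \<alpha>: "\<alpha> \<in> maps k l" and y: "y \<in> simplices X l"
  shows "edge_family k (act X k l \<alpha> y) = act (group_nerve G) k l \<alpha> (edge_family l y)"
proof -
  have "\<alpha> i \<le> l" if "i \<le> k" for i using \<alpha> that by (auto simp: maps_def)
  then show ?thesis
    using edge_act[OF \<alpha> y] by (auto simp: fun_eq_iff edge_family_def group_nerve_def)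
qed

lemma is_group: "is_group_symset X"
  unfolding is_group_symset_def symset_iso_def
  using group_edges edge_family_bij edge_family_natural by blast

end

section \<open>Counting edges\<close>

lemma (in symmetric_set) connected_object_unique:
  assumes conn: "connected_symset X" and loops: "edge_relation X \<subseteq> Id"
    and v: "v \<in> simplices X 0" and w: "w \<in> simplices X 0"
  shows "v = w"
proof -
  have "(v, w) \<in> (edge_relation X \<union> (edge_relation X)\<inverse>)\<^sup>*"
    using conn v w unfolding connected_symset_def by blast
  also have "\<dots> \<subseteq> Id"
    using loops rtrancl_subset_rtrancl[of "edge_relation X \<union> (edge_relation X)\<inverse>" Id] by auto
  finally show ?thesis by simp
qed

theorem corollary19:
  fixes X :: "'a symset" and m :: nat
  assumes "partial_groupoid X"
    and "connected_symset X"
    and "has_dimension X m"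
    and "finite (nonidentity_edges X)"
    and "card (nonidentity_edges X) \<le> m"
  shows "is_group_symset X"
proof -
  interpret partial_groupoid X by fact
  obtain x where x: "x \<in> simplices X m" and inj: "\<And>c. c \<le> m \<Longrightarrow> inj_on (edge X m x c) {..m}"
    using dimension_edges_distinct[OF assms(3)] by blast
  have all: "\<exists>j\<le>m. edge X m x c j = f" if c: "c \<le> m" and f: "f \<in> nonidentity_edges X" for c f
  proof -
    let ?E = "edge X m x c ` ({..m} - {c})"
    have "?E \<subseteq> nonidentity_edges X"
    proof
      fix g assume "g \<in> ?E"
      then obtain j where j: "j \<le> m" "j \<noteq> c" "g = edge X m x c j" by auto
      then have "g \<noteq> edge X m x c c"
        using inj[OF c] c by (auto simp: inj_on_def)
      then show "g \<in> nonidentity_edges X"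
        using edge_identity_iff[OF x c j(1)] edge_closed[OF x c j(1)] j(3)
        unfolding nonidentity_edges_def by simp
    qed
    moreover have "card ?E = m"
      using card_image[OF inj_on_subset[OF inj[OF c]], of "{..m} - {c}"] c by simp
    ultimately have "?E = nonidentity_edges X"
      using card_seteq[OF assms(4)] assms(5) by simp
    with f show ?thesis by (metis DiffD1 atMost_iff imageE)
  qed
  have source: "vertex X 1 f 0 = vertex X m x 0" if "f \<in> nonidentity_edges X" for f
    using all[OF _ that, of 0] vertex_edge[OF x, of 0 _ 0] by auto
  have loop: "vertex X 1 f 0 = vertex X 1 f 1" if f: "f \<in> simplices X 1" for f
  proof (cases "f \<in> nonidentity_edges X")
    case True
    \<comment> \<open>The reverse of a nonidentity edge is a nonidentity edge, so it starts at the same object.\<close>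
    let ?r = "edge X 1 f 1 0"
    have "?r \<in> nonidentity_edges X"
    proof (rule ccontr)
      assume "?r \<notin> nonidentity_edges X"
      then have "?r \<in> identity_edge X ` simplices X 0"
        using edge_closed[OF f, of 1 0] unfolding nonidentity_edges_def by simp
      then have "?r = edge X 1 f 1 1" using edge_identity_iff[OF f] by simp
      then have "edge X 1 f 0 1 = edge X 1 f 1 1"
        using edge_flip[OF f, of 1 0] edge_flip[OF f, of 1 1] by simp
      then have "f = identity_edge X (vertex X 1 f 1)"
        using edge_of_edge[OF f] identity_edge_vertex[OF f, of 1] by simp
      with True vertex_closed[OF f, of 1] show False
        unfolding nonidentity_edges_def by auto
    qed
    from source[OF this] source[OF True] show ?thesis
      using vertex_edge[OF f, of 1 0 0] by simp
  next
    case False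
    then obtain v where "v \<in> simplices X 0" "f = identity_edge X v"
      using f unfolding nonidentity_edges_def by auto
    then show ?thesis using vertex_identity_edge[of v] by simp
  qed
  from loop have "edge_relation X \<subseteq> Id"
    unfolding edge_relation_def vertex_def by auto
  then have obj: "v = w" if "v \<in> simplices X 0" "w \<in> simplices X 0" for v w
    using connected_object_unique[OF assms(2)] that by blast
  have "\<exists>j\<le>m. edge X m x c j = f" if c: "c \<le> m" and f: "f \<in> simplices X 1" for c f
  proof (cases "f \<in> nonidentity_edges X")
    case True
    with all[OF c] show ?thesis .
  next
    case False
    then obtain v where "v \<in> simplices X 0" "f = identity_edge X v"
      using f unfolding nonidentity_edges_def by auto
    then have "edge X m x c c = f"
      using identity_edge_vertex[OF x c] obj[OF vertex_closed[OF x c]] by metis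
    with c show ?thesis by blast
  qed
  then interpret universal_simplex X x m
    using x by unfold_locales
  show ?thesis by (rule is_group)
qed

end
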